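(* Let $f$ be a meromorphic quasi-modular form of weight $k$ and depth $p$ with $k/2\le p<k$. Then $f$ is never a finite linear combination $\sum_{l=0}^{l_0}D^lF_{k-2l}$ of iterated derivatives of meromorphic modular forms $F_{k-2l}$ of weight $k-2l$.
   Context: $\mathcal H$ is the upper half-plane, $q=e^{2\pi i\tau}$, $(f|_k\gamma)(\tau)=(c\tau+d)^{-k}f(\frac{a\tau+b}{c\tau+d})$. A meromorphic modular form of weight $k$ is a meromorphic $f$ on $\mathcal H$ invariant under $|_k\gamma$ for all $\gamma\in SL_2(\mathbb Z)$ and meromorphic at infinity (Fourier expansion $\sum_{n\ge -n_0}a(n)q^n$). A meromorphic quasi-modular form of weight $k$ is a meromorphic $f$ on $\mathcal H$ with functions $f_0,\dots,f_p$ meromorphic on $\mathcal H$ and at infinity such that $(f|_k\gamma)(\tau)=\sum_{r=0}^pf_r(\tau)(c/(c\tau+d))^r$ for all $\gamma=\begin{pmatrix}a&b\\c&d\end{pmatrix}\in SL_2(\mathbb Z)$; its depth is $p$ if $f_p\neq0$. $D=\frac{1}{2\pi i}\frac{d}{d\tau}$. *)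

theory Defs
  imports "HOL-Complex_Analysis.Complex_Analysis"
begin

text \<open>
  Meromorphic functions are represented by total functions satisfying \<^const>\<open>meromorphic_on\<close>,
  whose values at poles and removable singularities carry no information.  An identity between
  meromorphic functions is therefore required only off a set without accumulation points in the
  domain, i.e. with the quantifier \<open>\<forall>\<^sub>\<approx>\<close> of the filter \<^const>\<open>cosparse\<close>.
\<close>

definition upper_half_plane :: "complex set" where
  "upper_half_plane = {\<tau>. Im \<tau> > 0}"

definition slash :: "int \<Rightarrow> int \<Rightarrow> int \<Rightarrow> int \<Rightarrow> int \<Rightarrow> (complex \<Rightarrow> complex) \<Rightarrow> complex \<Rightarrow> complex" where
  "slash k a b c d f \<tau> =
     (of_int c * \<tau> + of_int d) powi (- k) *
     f ((of_int a * \<tau> + of_int b) / (of_int c * \<tau> + of_int d))"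

text \<open>
  A function with poles in the upper half-plane has its \<open>q\<close>-expansion, \<open>q = exp (2 \<pi> \<i> \<tau>)\<close>,
  only in a neighbourhood of infinity, i.e. for \<open>Im \<tau> > Y\<close> with some \<open>Y\<close>.
\<close>

definition meromorphic_at_ioo :: "(complex \<Rightarrow> complex) \<Rightarrow> bool" where
  "meromorphic_at_ioo f \<longleftrightarrow>
     (\<exists>(n0 :: int) (a :: int \<Rightarrow> complex) (Y :: real). Y \<ge> 0 \<and>
        (\<forall>\<^sub>\<approx>\<tau>\<in>{\<tau>. Im \<tau> > Y}.
           ((\<lambda>n. a n * exp (2 * of_real pi * \<i> * \<tau>) powi n) has_sum f \<tau>) {- n0..}))"

definition meromorphic_modular_form :: "int \<Rightarrow> (complex \<Rightarrow> complex) \<Rightarrow> bool" where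
  "meromorphic_modular_form k f \<longleftrightarrow>
     f meromorphic_on upper_half_plane \<and>
     (\<forall>a b c d :: int. a * d - b * c = 1 \<longrightarrow>
        (\<forall>\<^sub>\<approx>\<tau>\<in>upper_half_plane. slash k a b c d f \<tau> = f \<tau>)) \<and>
     meromorphic_at_ioo f"

definition quasimodular_expansion ::
    "int \<Rightarrow> (complex \<Rightarrow> complex) \<Rightarrow> nat \<Rightarrow> (nat \<Rightarrow> complex \<Rightarrow> complex) \<Rightarrow> bool" where
  "quasimodular_expansion k f p g \<longleftrightarrow>
     (\<forall>r\<le>p. g r meromorphic_on upper_half_plane \<and> meromorphic_at_ioo (g r)) \<and>
     (\<forall>a b c d :: int. a * d - b * c = 1 \<longrightarrow>
        (\<forall>\<^sub>\<approx>\<tau>\<in>upper_half_plane.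
           slash k a b c d f \<tau> = (\<Sum>r\<le>p. g r \<tau> * (of_int c / (of_int c * \<tau> + of_int d)) ^ r)))"

definition meromorphic_quasimodular_form :: "int \<Rightarrow> (complex \<Rightarrow> complex) \<Rightarrow> bool" where
  "meromorphic_quasimodular_form k f \<longleftrightarrow>
     f meromorphic_on upper_half_plane \<and> (\<exists>p g. quasimodular_expansion k f p g)"

definition has_quasimodular_depth :: "int \<Rightarrow> (complex \<Rightarrow> complex) \<Rightarrow> nat \<Rightarrow> bool" where
  "has_quasimodular_depth k f p \<longleftrightarrow>
     (\<exists>g. quasimodular_expansion k f p g \<and> \<not> (\<forall>\<^sub>\<approx>\<tau>\<in>upper_half_plane. g p \<tau> = 0))"

definition D :: "(complex \<Rightarrow> complex) \<Rightarrow> complex \<Rightarrow> complex" where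
  "D f \<tau> = 1 / (2 * of_real pi * \<i>) * deriv f \<tau>"

end

theory Submission
  imports Defs
begin

text \<open>
  The matrices \<open>(1 0; c 1)\<close> alone suffice.  If \<open>F\<close> is modular of weight \<open>k - 2 l\<close>, the coefficient
  of \<open>(c / (c \<tau> + 1))\<^sup>r\<close> in the transformation of \<open>D\<^sup>l F\<close> is \<open>D\<^sup>l\<^sup>-\<^sup>r F\<close> times a constant containing
  the factor \<open>(k - l - 1) (k - l - 2) \<dots> (k - l - r)\<close>.  For \<open>k / 2 \<le> l < k\<close> and \<open>r \<ge> k / 2\<close> one of
  these factors is zero; for \<open>l \<ge> k\<close> all of them are negative.  Hence if some \<open>F\<close> with \<open>l \<ge> k\<close> is
  nonzero, the linear combination has depth at least \<open>k\<close>, and otherwise its depth is less than \<open>k / 2\<close>.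
\<close>

section \<open>Constants in the transformation law of iterated derivatives\<close>

text \<open>The product is the falling factorial of \<open>w + l - 1\<close> with \<open>r\<close>
  factors. It is kept as an integer product because the weight \<open>w\<close> may be negative,
  where a quotient of factorials would make no sense.\<close>

definition slash_coeff :: "int \<Rightarrow> nat \<Rightarrow> nat \<Rightarrow> complex" where
  "slash_coeff w l r =
     of_nat (l choose r) * (\<Prod>i<r. of_int (w + int l - 1 - int i)) / (2 * of_real pi * \<i>) ^ r"

lemma slash_coeff_eq_0 [simp]: "l < r \<Longrightarrow> slash_coeff w l r = 0"
  by (simp add: slash_coeff_def)

lemma slash_coeff_0 [simp]: "slash_coeff w l 0 = 1"
  by (simp add: slash_coeff_def)

text \<open>The effect of one more differentiation: differentiating the derivative of the form keeps
  the index, while differentiating the automorphy factor of exponent \<open>w + 2 * l - r\<close>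
  raises \<open>r\<close> by one.\<close>

lemma slash_coeff_Suc_Suc:
  "slash_coeff w (Suc l) (Suc r) =
     slash_coeff w l (Suc r) + of_int (w + 2 * int l - int r) / (2 * of_real pi * \<i>) * slash_coeff w l r"
proof -
  define P :: complex where "P = (\<Prod>i<r. of_int (w + int l - 1 - int i))"
  define e :: complex where "e = (2 * of_real pi * \<i>) ^ r"
  have e: "e \<noteq> 0"
    by (simp add: e_def)
  \<comment> \<open>Both longer products contain \<open>P\<close>: for \<open>Suc l\<close> the
    extra factor is the first one, for \<open>l\<close> the last one. What remains is a binomial
    identity.\<close>
  have shift: "(\<Prod>i<Suc r. of_int (w + int (Suc l) - 1 - int i)) = of_int (w + int l) * P"
    unfolding P_def by (subst prod.lessThan_Suc_shift) (auto intro!: prod.cong simp: algebra_simps)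
  have last: "(\<Prod>i<Suc r. of_int (w + int l - 1 - int i)) = P * of_int (w + int l - 1 - int r)"
    unfolding P_def by simp
  \<comment> \<open>Absorption, rearranged without subtraction of naturals so that it carries over
    to the complex numbers.\<close>
  have "Suc r * (l choose Suc r) + r * (l choose r) = l * (l choose r)"
  proof (cases "r \<le> l")
    case True
    have "Suc r * (l choose Suc r) = (l - r) * (l choose r)"
      by (simp only: binomial_absorption binomial_absorb_comp)
    then show ?thesis
      using True by (simp only: add_mult_distrib[symmetric] le_add_diff_inverse2)
  qed (simp add: binomial_eq_0)
  then have "of_nat (Suc r * (l choose Suc r) + r * (l choose r)) = (of_nat (l * (l choose r)) :: complex)"
    by (rule arg_cong)
  then have binom: "(of_nat r + 1) * of_nat (l choose Suc r) + of_nat r * of_nat (l choose r)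
                    = (of_nat l * of_nat (l choose r) :: complex)"
    by (simp add: algebra_simps)
  have "(of_nat (l choose r) + of_nat (l choose Suc r)) * (of_int w + of_nat l) =
        of_nat (l choose Suc r) * (of_int w + of_nat l - 1 - of_nat r)
        + (of_int w + 2 * of_nat l - of_nat r) * (of_nat (l choose r) :: complex)"
    using binom by (simp add: algebra_simps)
  from arg_cong[OF this, of "\<lambda>x. x * P"]
  have "(of_nat (l choose r) + of_nat (l choose Suc r)) * ((of_int w + of_nat l) * P) =
        of_nat (l choose Suc r) * (P * (of_int w + of_nat l - 1 - of_nat r))
        + (of_int w + 2 * of_nat l - of_nat r) * (of_nat (l choose r) * P)"
    by (simp add: algebra_simps)
  then show ?thesis
    unfolding slash_coeff_def shift last P_def[symmetric] power_Suc e_def[symmetric]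
    using e by (simp add: divide_simps)
qed

text \<open>The falling factorial starts at \<open>k - l - 1\<close>, which is nonnegative since
  \<open>l < k\<close>, and descends in steps of one. Since
  \<open>k - l \<le> k / 2 \<le> r\<close>, it reaches 0 within its \<open>r\<close>
  factors.\<close>

lemma slash_coeff_vanish:
  assumes "k \<le> 2 * int r" "k \<le> 2 * int l" "int l < k"
  shows "slash_coeff (k - 2 * int l) l r = 0"
proof -
  define m where "m = nat (k - int l - 1)"
  have "m \<in> {..<r}" "k - 2 * int l + int l - 1 - int m = 0"
    using assms by (auto simp: m_def)
  then have "\<exists>i\<in>{..<r}. of_int (k - 2 * int l + int l - 1 - int i) = (0::complex)"
    unfolding of_int_eq_0_iff by blast
  then have "(\<Prod>i<r. of_int (k - 2 * int l + int l - 1 - int i)) = (0::complex)"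
    by (intro prod_zero finite_lessThan)
  then show ?thesis
    by (simp add: slash_coeff_def)
qed

lemma slash_coeff_diag_nonzero:
  assumes "k \<le> int l"
  shows "slash_coeff (k - 2 * int l) l l \<noteq> 0"
proof -
  have "of_int (k - 2 * int l + int l - 1 - int i) \<noteq> (0::complex)" for i
    using assms unfolding of_int_eq_0_iff by linarith
  then show ?thesis
    by (simp only: slash_coeff_def) (simp del: of_int_add of_int_diff)
qed

section \<open>Differentiating the modular transformation law\<close>

lemma D_analytic: "F analytic_on S \<Longrightarrow> D F analytic_on S"
  unfolding D_def[abs_def] by (intro analytic_on_mult analytic_on_const analytic_deriv)

lemma D_funpow_analytic: "F analytic_on S \<Longrightarrow> (D ^^ l) F analytic_on S"
  by (induction l) (simp_all add: D_analytic)

text \<open>Induction on \<open>l\<close>, differentiating both sides of the identity for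
  \<open>l\<close>. The hypotheses hold on a whole open set because an identity at a single point
  cannot be differentiated.\<close>

lemma D_funpow_transform:
  fixes c :: complex and w :: int
  assumes U: "open U" and nz: "\<And>z. z \<in> U \<Longrightarrow> c * z + 1 \<noteq> 0"
    and F: "\<And>z. z \<in> U \<Longrightarrow> F analytic_on {z}"
    and F': "\<And>z. z \<in> U \<Longrightarrow> F analytic_on {z / (c * z + 1)}"
    and eq: "\<And>z. z \<in> U \<Longrightarrow> F (z / (c * z + 1)) = (c * z + 1) powi w * F z"
    and z: "z \<in> U"
  shows "(D ^^ l) F (z / (c * z + 1)) =
    (\<Sum>r\<le>l. slash_coeff w l r * c ^ r * (c * z + 1) powi (w + 2 * int l - int r) * (D ^^ (l - r)) F z)"
  using z
proof (induction l arbitrary: z)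
  case 0
  then show ?case by (simp add: eq)
next
  case (Suc l)
  define j where "j = c * z + 1"
  define K :: complex where "K = 2 * of_real pi * \<i>"
  have j: "j \<noteq> 0" and K: "K \<noteq> 0"
    using nz[OF Suc.prems] by (auto simp: j_def K_def)
  have DK: "deriv ((D ^^ m) F) x = K * (D ^^ Suc m) F x" for m x
    by (simp add: D_def K_def)
  have deriv_at: "((D ^^ m) F has_field_derivative K * (D ^^ Suc m) F x) (at x)"
    if "F analytic_on {x}" for m x
    using analytic_on_imp_differentiable_at[OF D_funpow_analytic[OF that], of x m]
    unfolding DK[symmetric] by (simp add: DERIV_deriv_iff_field_differentiable)
  have mob: "((\<lambda>z. z / (c * z + 1)) has_field_derivative 1 / j ^ 2) (at z)"
    using j unfolding j_def
    by (auto intro!: derivative_eq_intros simp: power2_eq_square field_simps)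
  have lhs: "((\<lambda>z. (D ^^ l) F (z / (c * z + 1))) has_field_derivative
               K * (D ^^ Suc l) F (z / (c * z + 1)) * (1 / j ^ 2)) (at z)"
    by (rule DERIV_chain2[OF deriv_at[OF F'[OF Suc.prems]] mob])
  \<comment> \<open>Product rule for the \<open>r\<close>-th summand: first the power of
    \<open>c * z + 1\<close>, then the derivative of \<open>F\<close>.\<close>
  define T where "T = (\<lambda>r. slash_coeff w l r * c ^ r *
      (of_int (w + 2 * int l - int r) * j powi (w + 2 * int l - int r - 1) * c * (D ^^ (l - r)) F z
       + j powi (w + 2 * int l - int r) * (K * (D ^^ Suc (l - r)) F z)))"
  have rhs: "((\<lambda>z. \<Sum>r\<le>l. slash_coeff w l r * c ^ r * (c * z + 1) powi (w + 2 * int l - int r) *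
               (D ^^ (l - r)) F z) has_field_derivative (\<Sum>r\<le>l. T r)) (at z)"
  proof (rule DERIV_sum)
    fix r
    have "((\<lambda>z. (c * z + 1) powi (w + 2 * int l - int r)) has_field_derivative
            of_int (w + 2 * int l - int r) * j powi (w + 2 * int l - int r - 1) * c) (at z)"
      using j unfolding j_def by (auto intro!: derivative_eq_intros)
    from DERIV_mult[OF this deriv_at[OF F[OF Suc.prems]], of "l - r"]
    show "((\<lambda>z. slash_coeff w l r * c ^ r * (c * z + 1) powi (w + 2 * int l - int r) *
               (D ^^ (l - r)) F z) has_field_derivative T r) (at z)"
      unfolding T_def mult.assoc[of "slash_coeff w l r * c ^ r"]
      by (intro DERIV_cmult) (simp add: j_def algebra_simps)
  qed
  have "((\<lambda>z. (D ^^ l) F (z / (c * z + 1))) has_field_derivative (\<Sum>r\<le>l. T r)) (at z)"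
    by (rule has_field_derivative_transform_within_open[OF rhs U Suc.prems])
       (simp add: Suc.IH)
  from DERIV_unique[OF lhs this]
  have "(D ^^ Suc l) F (z / (c * z + 1)) = j ^ 2 / K * (\<Sum>r\<le>l. T r)"
    using j K by (simp add: field_simps)
  then have step: "(D ^^ Suc l) F (z / (c * z + 1)) = (\<Sum>r\<le>l. j ^ 2 / K * T r)"
    by (simp only: sum_distrib_left)
  \<comment> \<open>The summands wanted for \<open>Suc l\<close>, stripped of their constants. Each
    \<open>T r\<close> splits into a multiple of \<open>t r\<close> and a multiple of
    \<open>t (Suc r)\<close>.\<close>
  define t where "t = (\<lambda>r. c ^ r * j powi (w + 2 * int (Suc l) - int r) * (D ^^ (Suc l - r)) F z)"
  have T: "j ^ 2 / K * T r = slash_coeff w l r * t r +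
            of_int (w + 2 * int l - int r) / K * slash_coeff w l r * t (Suc r)" if "r \<le> l" for r
  proof -
    have "j powi (m + 2) = j powi m * j ^ 2" for m
      using power_int_add[of j m 2] j by simp
    from this[of "w + 2 * int l - int r"] this[of "w + 2 * int l - int r - 1"]
    have "j powi (w + 2 * int (Suc l) - int r) = j powi (w + 2 * int l - int r) * j ^ 2"
         "j powi (w + 2 * int (Suc l) - int (Suc r)) = j powi (w + 2 * int l - int r - 1) * j ^ 2"
      by (simp_all add: algebra_simps)
    then show ?thesis
      using K Suc_diff_le[OF that] unfolding T_def t_def
      by (simp add: field_simps)
  qed
  have "(\<Sum>r\<le>Suc l. slash_coeff w (Suc l) r * t r) =
        slash_coeff w l 0 * t 0 + (\<Sum>r\<le>l. slash_coeff w (Suc l) (Suc r) * t (Suc r))"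
    by (subst sum.atMost_Suc_shift) simp
  also have "\<dots> = (slash_coeff w l 0 * t 0 + (\<Sum>r\<le>l. slash_coeff w l (Suc r) * t (Suc r)))
      + (\<Sum>r\<le>l. of_int (w + 2 * int l - int r) / K * slash_coeff w l r * t (Suc r))"
    unfolding slash_coeff_Suc_Suc K_def[symmetric] distrib_right sum.distrib by (simp add: add.assoc)
  also have "slash_coeff w l 0 * t 0 + (\<Sum>r\<le>l. slash_coeff w l (Suc r) * t (Suc r)) =
             (\<Sum>r\<le>Suc l. slash_coeff w l r * t r)"
    by (subst sum.atMost_Suc_shift) simp
  \<comment> \<open>The top term drops out because \<open>slash_coeff w l (Suc l)\<close> is
    0.\<close>
  also have "\<dots> = (\<Sum>r\<le>l. slash_coeff w l r * t r)"
    by simp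
  also have "\<dots> + (\<Sum>r\<le>l. of_int (w + 2 * int l - int r) / K * slash_coeff w l r * t (Suc r))
             = (\<Sum>r\<le>l. j ^ 2 / K * T r)"
    unfolding sum.distrib[symmetric] by (intro sum.cong refl) (simp only: T atMost_iff)
  finally show ?case
    unfolding step by (simp add: t_def j_def mult.assoc)
qed

section \<open>The upper half-plane and identities off discrete sets\<close>

lemma open_upper_half_plane: "open upper_half_plane"
  unfolding upper_half_plane_def by (simp add: open_halfspace_Im_gt)

lemma upper_half_plane_denominator_nonzero:
  "z \<in> upper_half_plane \<Longrightarrow> of_int c * z + 1 \<noteq> 0"
  by (cases "c = 0") (auto simp: upper_half_plane_def complex_eq_iff)

lemma upper_half_plane_mobius:
  assumes "z \<in> upper_half_plane"
  shows "z / (of_int c * z + 1) \<in> upper_half_plane"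
proof -
  have nz: "of_int c * z + 1 \<noteq> 0"
    using upper_half_plane_denominator_nonzero[OF assms] .
  have "Im (z / (of_int c * z + 1)) = Im z / (cmod (of_int c * z + 1))\<^sup>2"
    by (simp add: Im_divide' cmod_power2 algebra_simps)
  then show ?thesis
    using assms nz by (simp add: upper_half_plane_def)
qed

text \<open>The map is continuous and injective on the half-plane and sends it into itself, so small
  punctured neighbourhoods go into punctured neighbourhoods of the image point.\<close>

lemma eventually_cosparse_mobius:
  assumes "\<forall>\<^sub>\<approx>z\<in>upper_half_plane. P z"
  shows "\<forall>\<^sub>\<approx>z\<in>upper_half_plane. P (z / (of_int c * z + 1))"
  unfolding eventually_cosparse_open_eq[OF open_upper_half_plane]
proof
  fix x assume x: "x \<in> upper_half_plane"
  let ?g = "\<lambda>z::complex. z / (of_int c * z + 1)"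
  have "\<forall>\<^sub>F z in at (?g x). P z"
    using assms upper_half_plane_mobius[OF x]
    by (auto simp: eventually_cosparse_open_eq[OF open_upper_half_plane])
  moreover have "filterlim ?g (at (?g x)) (at x)"
    unfolding filterlim_at
  proof
    show "\<forall>\<^sub>F y in at x. ?g y \<in> UNIV \<and> ?g y \<noteq> ?g x"
      using eventually_at_in_open[OF open_upper_half_plane x]
    proof eventually_elim
      case (elim y)
      then show ?case
        using upper_half_plane_denominator_nonzero[of x c] upper_half_plane_denominator_nonzero[of y c] x
        by (auto simp: field_simps)
    qed
    show "?g \<midarrow>x\<rightarrow> ?g x"
      using upper_half_plane_denominator_nonzero[OF x] by (intro tendsto_intros)
  qed
  ultimately show "\<forall>\<^sub>F z in at x. P (?g z)"
    by (rule eventually_compose_filterlim)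
qed

text \<open>Makes identities off a discrete set differentiable: a point \<open>z\<close> of a
  punctured neighbourhood of \<open>x\<close> has a whole neighbourhood that avoids
  \<open>x\<close>.\<close>

lemma eventually_cosparse_eventually_nhds:
  fixes S :: "'a::t1_space set"
  assumes "open S" "\<forall>\<^sub>\<approx>z\<in>S. P z"
  shows "\<forall>\<^sub>\<approx>z\<in>S. \<forall>\<^sub>F y in nhds z. P y"
  unfolding eventually_cosparse_open_eq[OF assms(1)]
proof
  fix x assume "x \<in> S"
  then have "\<forall>\<^sub>F z in at x. P z"
    using assms by (auto simp: eventually_cosparse_open_eq)
  then obtain U where U: "open U" "x \<in> U" "\<And>z. z \<in> U - {x} \<Longrightarrow> P z"
    by (auto simp: eventually_at_topological)
  from eventually_at_in_open[OF U(1,2)] show "\<forall>\<^sub>F z in at x. \<forall>\<^sub>F y in nhds z. P y"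
  proof eventually_elim
    case (elim z)
    have "open (U - {x})"
      using U(1) by (rule open_delete)
    then have "\<forall>\<^sub>F y in nhds z. y \<in> U - {x}"
      using elim by (intro eventually_nhds_in_open) auto
    then show ?case
      by (rule eventually_mono) (rule U(3))
  qed
qed

lemma eventually_in_cosparse_open:
  assumes "open S" shows "\<forall>\<^sub>\<approx>z\<in>S. z \<in> S"
  using eventually_in_cosparse[of S S] assms by simp

lemma cosparse_D_funpow_zero:
  assumes "open S" "\<forall>\<^sub>\<approx>z\<in>S. F z = 0"
  shows "\<forall>\<^sub>\<approx>z\<in>S. (D ^^ l) F z = 0"
proof (induction l)
  case 0
  then show ?case using assms by simp
next
  case (Suc l)
  from eventually_cosparse_eventually_nhds[OF assms(1) this] show ?case
  proof eventually_elim
    case (elim z)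
    then have "deriv ((D ^^ l) F) z = deriv (\<lambda>_. 0) z"
      by (intro deriv_cong_ev) auto
    then show ?case by (simp add: D_def[of "(D ^^ l) F"])
  qed
qed

section \<open>Slash action on derivatives of modular forms\<close>

lemma D_funpow_modular_slash:
  assumes F: "meromorphic_modular_form w F"
  shows "\<forall>\<^sub>\<approx>z\<in>upper_half_plane. slash (w + 2 * int l) 1 0 c 1 ((D ^^ l) F) z =
    (\<Sum>r\<le>l. slash_coeff w l r * (D ^^ (l - r)) F z * (of_int c / (of_int c * z + 1)) ^ r)"
proof -
  let ?H = upper_half_plane and ?c = "of_int c :: complex"
  have "F meromorphic_on ?H"
    using F by (simp add: meromorphic_modular_form_def)
  then have an: "\<forall>\<^sub>\<approx>z\<in>?H. F analytic_on {z}"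
    by (rule meromorphic_on_imp_analytic_cosparse)
  have "\<forall>\<^sub>\<approx>z\<in>?H. slash w 1 0 c 1 F z = F z"
    using F by (simp add: meromorphic_modular_form_def)
  \<comment> \<open>The exceptional points are the non-analytic points of \<open>F\<close>, their
    preimages under the transformation, and the points where invariance fails for the chosen
    values.\<close>
  then have "\<forall>\<^sub>\<approx>z\<in>?H. z \<in> ?H \<and> F analytic_on {z} \<and> F analytic_on {z / (?c * z + 1)} \<and>
      slash w 1 0 c 1 F z = F z"
    by (intro eventually_conj an eventually_cosparse_mobius
        eventually_in_cosparse_open open_upper_half_plane)
  from eventually_cosparse_eventually_nhds[OF open_upper_half_plane this] show ?thesis
  proof eventually_elim
    case (elim z)
    then obtain U where U: "open U" "z \<in> U" and U_props:
      "\<And>y. y \<in> U \<Longrightarrow> y \<in> ?H \<and> F analytic_on {y} \<and> F analytic_on {y / (?c * y + 1)} \<and>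
         slash w 1 0 c 1 F y = F y"
      by (auto simp: eventually_nhds)
    have nz: "?c * y + 1 \<noteq> 0" if "y \<in> U" for y
      using U_props[OF that] upper_half_plane_denominator_nonzero by blast
    have eq: "F (y / (?c * y + 1)) = (?c * y + 1) powi w * F y" if "y \<in> U" for y
      using U_props[OF that] nz[OF that] by (auto simp: slash_def power_int_minus field_simps)
    define j where "j = ?c * z + 1"
    have j: "j \<noteq> 0"
      using nz[OF U(2)] by (simp add: j_def)
    have pw: "j powi (- (w + 2 * int l)) * j powi (w + 2 * int l - int r) = 1 / j ^ r" for r
      using j by (simp add: power_int_minus field_simps flip: power_int_add)
    have "slash (w + 2 * int l) 1 0 c 1 ((D ^^ l) F) z =
      j powi (- (w + 2 * int l)) * (D ^^ l) F (z / (?c * z + 1))"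
      by (simp add: slash_def j_def)
    also have "\<dots> = (\<Sum>r\<le>l. j powi (- (w + 2 * int l)) *
       (slash_coeff w l r * ?c ^ r * j powi (w + 2 * int l - int r) * (D ^^ (l - r)) F z))"
      unfolding j_def sum_distrib_left[symmetric]
      by (subst D_funpow_transform[OF U(1) nz _ _ eq U(2)]) (use U_props in auto)
    also have "\<dots> = (\<Sum>r\<le>l. slash_coeff w l r * (D ^^ (l - r)) F z * ?c ^ r *
        (j powi (- (w + 2 * int l)) * j powi (w + 2 * int l - int r)))"
      by (simp only: mult_ac)
    also have "\<dots> = (\<Sum>r\<le>l. slash_coeff w l r * (D ^^ (l - r)) F z * (?c / j) ^ r)"
      unfolding pw by (simp add: power_divide)
    finally show ?case
      by (simp add: j_def)
  qed
qed

text \<open>For fixed \<open>z\<close> the points \<open>c / (c * z + 1)\<close> with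
  \<open>c = 0, ..., N\<close> are distinct. A polynomial of degree at most \<open>N\<close> with
  these \<open>N + 1\<close> roots is zero.\<close>

lemma coeffs_eq_of_slash_values:
  fixes a b :: "nat \<Rightarrow> complex"
  assumes z: "z \<in> upper_half_plane"
    and eq: "\<And>c. c \<le> N \<Longrightarrow>
      (\<Sum>r\<le>N. a r * (of_nat c / (of_nat c * z + 1)) ^ r) = (\<Sum>r\<le>N. b r * (of_nat c / (of_nat c * z + 1)) ^ r)"
    and "r \<le> N"
  shows "a r = b r"
proof -
  let ?X = "\<lambda>c::nat. of_nat c / (of_nat c * z + 1)"
  have nz: "of_nat c * z + 1 \<noteq> 0" for c :: nat
    using upper_half_plane_denominator_nonzero[OF z, of "int c"] by simp
  have "inj ?X"
    using nz by (intro injI) (auto simp: field_simps)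
  then have card: "card (?X ` {..N}) = Suc N"
    by (simp add: card_image inj_on_subset)
  show ?thesis
  proof (rule ccontr)
    assume "a r \<noteq> b r"
    with \<open>r \<le> N\<close> have "\<exists>k\<le>N. a k - b k \<noteq> 0" by auto
    from polyfun_rootbound[OF this]
    have fin: "finite {x. (\<Sum>i\<le>N. (a i - b i) * x ^ i) = 0}"
      and le: "card {x. (\<Sum>i\<le>N. (a i - b i) * x ^ i) = 0} \<le> N"
      by auto
    have "?X ` {..N} \<subseteq> {x. (\<Sum>i\<le>N. (a i - b i) * x ^ i) = 0}"
      using eq by (auto simp: algebra_simps sum_subtractf)
    from card_mono[OF fin this] card le show False by simp
  qed
qed

section \<open>Comparing the two expansions of \<open>f\<close>\<close>

theorem theorem4p5:
  fixes f :: "complex \<Rightarrow> complex" and k :: int and p :: nat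
  assumes "meromorphic_quasimodular_form k f"
    and "has_quasimodular_depth k f p"
    and "real_of_int k / 2 \<le> real p" and "int p < k"
  shows "\<not> (\<exists>(l0 :: nat) (F :: int \<Rightarrow> complex \<Rightarrow> complex).
           (\<forall>l\<le>l0. meromorphic_modular_form (k - 2 * int l) (F (k - 2 * int l))) \<and>
           (\<forall>\<^sub>\<approx>\<tau>\<in>upper_half_plane. f \<tau> = (\<Sum>l=0..l0. (D ^^ l) (F (k - 2 * int l)) \<tau>)))"
proof
  let ?H = upper_half_plane
  assume "\<exists>(l0 :: nat) (F :: int \<Rightarrow> complex \<Rightarrow> complex).
           (\<forall>l\<le>l0. meromorphic_modular_form (k - 2 * int l) (F (k - 2 * int l))) \<and>
           (\<forall>\<^sub>\<approx>\<tau>\<in>?H. f \<tau> = (\<Sum>l=0..l0. (D ^^ l) (F (k - 2 * int l)) \<tau>))"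
  then obtain l0 F' where
    F': "\<And>l. l \<le> l0 \<Longrightarrow> meromorphic_modular_form (k - 2 * int l) (F' (k - 2 * int l))" and
    f': "\<forall>\<^sub>\<approx>\<tau>\<in>?H. f \<tau> = (\<Sum>l=0..l0. (D ^^ l) (F' (k - 2 * int l)) \<tau>)"
    by blast
  define F where "F = (\<lambda>l::nat. F' (k - 2 * int l))"
  have F: "meromorphic_modular_form (k - 2 * int l) (F l)" if "l \<le> l0" for l
    using F'[OF that] by (simp add: F_def)
  have f: "\<forall>\<^sub>\<approx>\<tau>\<in>?H. f \<tau> = (\<Sum>l\<le>l0. (D ^^ l) (F l) \<tau>)"
    using f' by (simp add: F_def atLeast0AtMost)
  obtain g where g: "quasimodular_expansion k f p g" and gp: "\<not> (\<forall>\<^sub>\<approx>\<tau>\<in>?H. g p \<tau> = 0)"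
    using assms(2) by (auto simp: has_quasimodular_depth_def)
  define N where "N = max p l0"
  \<comment> \<open>The coefficient of the \<open>r\<close>-th power contributed by the linear
    combination, independent of \<open>c\<close>. Terms with \<open>l < r\<close>, where
    \<open>l - r\<close> truncates to 0, vanish through \<open>slash_coeff\<close>.\<close>
  define h where "h = (\<lambda>r \<tau>. \<Sum>l\<le>l0. slash_coeff (k - 2 * int l) l r * (D ^^ (l - r)) (F l) \<tau>)"
  have "\<forall>\<^sub>\<approx>\<tau>\<in>?H. slash k 1 0 (int c) 1 f \<tau> =
          (\<Sum>r\<le>N. h r \<tau> * (of_nat c / (of_nat c * \<tau> + 1)) ^ r)" for c :: nat
  proof -
    have "\<forall>\<^sub>\<approx>\<tau>\<in>?H. \<forall>l\<in>{..l0}. slash k 1 0 (int c) 1 ((D ^^ l) (F l)) \<tau> =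
      (\<Sum>r\<le>l. slash_coeff (k - 2 * int l) l r * (D ^^ (l - r)) (F l) \<tau> * (of_nat c / (of_nat c * \<tau> + 1)) ^ r)"
    proof (intro eventually_ball_finite ballI)
      fix l assume "l \<in> {..l0}"
      then show "\<forall>\<^sub>\<approx>\<tau>\<in>?H. slash k 1 0 (int c) 1 ((D ^^ l) (F l)) \<tau> =
        (\<Sum>r\<le>l. slash_coeff (k - 2 * int l) l r * (D ^^ (l - r)) (F l) \<tau> * (of_nat c / (of_nat c * \<tau> + 1)) ^ r)"
        using D_funpow_modular_slash[OF F, of l l "int c"] by simp
    qed simp
    with eventually_cosparse_mobius[OF f, of "int c"] show ?thesis
    proof eventually_elim
      case (elim \<tau>)
      let ?X = "of_nat c / (of_nat c * \<tau> + 1) :: complex"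
      have "slash k 1 0 (int c) 1 f \<tau> = (\<Sum>l\<le>l0. slash k 1 0 (int c) 1 ((D ^^ l) (F l)) \<tau>)"
        using elim(1) by (simp add: slash_def sum_distrib_left)
      also have "\<dots> = (\<Sum>l\<le>l0. \<Sum>r\<le>l. slash_coeff (k - 2 * int l) l r * (D ^^ (l - r)) (F l) \<tau> * ?X ^ r)"
        using elim(2) by simp
      also have "\<dots> = (\<Sum>l\<le>l0. \<Sum>r\<le>N. slash_coeff (k - 2 * int l) l r * (D ^^ (l - r)) (F l) \<tau> * ?X ^ r)"
        by (intro sum.cong refl sum.mono_neutral_left) (auto simp: N_def)
      also have "\<dots> = (\<Sum>r\<le>N. h r \<tau> * ?X ^ r)"
        by (subst sum.swap) (simp add: h_def sum_distrib_right)
      finally show ?case .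
    qed
  qed
  moreover have "\<forall>\<^sub>\<approx>\<tau>\<in>?H. slash k 1 0 (int c) 1 f \<tau> =
      (\<Sum>r\<le>N. (if r \<le> p then g r \<tau> else 0) * (of_nat c / (of_nat c * \<tau> + 1)) ^ r)" for c :: nat
  proof -
    \<comment> \<open>The given expansion at the same matrix; the instantiation follows the order
      \<open>a\<close>, \<open>d\<close>, \<open>b\<close>, \<open>c\<close> of the determinant
      condition.\<close>
    have "\<forall>\<^sub>\<approx>\<tau>\<in>?H. slash k 1 0 (int c) 1 f \<tau> =
        (\<Sum>r\<le>p. g r \<tau> * (of_int (int c) / (of_int (int c) * \<tau> + of_int 1)) ^ r)"
      using g[unfolded quasimodular_expansion_def, THEN conjunct2, rule_format, of 1 1 0 "int c"] by simp
    then show ?thesis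
    proof eventually_elim
      case (elim \<tau>)
      also have "(\<Sum>r\<le>p. g r \<tau> * (of_int (int c) / (of_int (int c) * \<tau> + of_int 1)) ^ r) =
        (\<Sum>r\<le>N. (if r \<le> p then g r \<tau> else 0) * (of_nat c / (of_nat c * \<tau> + 1)) ^ r)"
        by (intro sum.mono_neutral_cong_left) (auto simp: N_def)
      finally show ?case .
    qed
  qed
  ultimately have "\<forall>\<^sub>\<approx>\<tau>\<in>?H.
      (\<Sum>r\<le>N. h r \<tau> * (of_nat c / (of_nat c * \<tau> + 1)) ^ r) =
      (\<Sum>r\<le>N. (if r \<le> p then g r \<tau> else 0) * (of_nat c / (of_nat c * \<tau> + 1)) ^ r)" for c :: nat
    by (rule eventually_elim2) (rule trans[OF sym])
  \<comment> \<open>Finitely many \<open>c\<close> suffice to compare coefficients, so one discrete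
    exceptional set serves them all.\<close>
  then have "\<forall>\<^sub>\<approx>\<tau>\<in>?H. \<tau> \<in> ?H \<and> (\<forall>c\<in>{..N}.
      (\<Sum>r\<le>N. h r \<tau> * (of_nat c / (of_nat c * \<tau> + 1)) ^ r) =
      (\<Sum>r\<le>N. (if r \<le> p then g r \<tau> else 0) * (of_nat c / (of_nat c * \<tau> + 1)) ^ r))"
    by (intro eventually_conj eventually_in_cosparse_open open_upper_half_plane
        eventually_ball_finite ballI) simp_all
  then have coeff: "\<forall>\<^sub>\<approx>\<tau>\<in>?H. \<forall>r\<le>N. h r \<tau> = (if r \<le> p then g r \<tau> else 0)"
  proof eventually_elim
    case (elim \<tau>)
    then have "h r \<tau> = (if r \<le> p then g r \<tau> else 0)" if "r \<le> N" for r
      using coeffs_eq_of_slash_values[where a = "\<lambda>r. h r \<tau>" and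
          b = "\<lambda>r. if r \<le> p then g r \<tau> else 0", OF _ _ that, of \<tau>] by simp
    then show ?case by blast
  qed
  \<comment> \<open>Descent from \<open>l0\<close>: once all later forms vanish, \<open>h l\<close>
    is a nonzero multiple of \<open>F l\<close>, and \<open>h l\<close> is 0 since
    \<open>l \<ge> k > p\<close>.\<close>
  have F_zero: "\<forall>\<^sub>\<approx>\<tau>\<in>?H. F l \<tau> = 0" if "k \<le> int l" "l \<le> l0" for l
    using that
  proof (induction "l0 - l" arbitrary: l rule: less_induct)
    case less
    have "\<forall>\<^sub>\<approx>\<tau>\<in>?H. \<forall>m\<in>{l<..l0}. (D ^^ (m - l)) (F m) \<tau> = 0"
      using less by (intro eventually_ball_finite ballI cosparse_D_funpow_zero open_upper_half_plane) auto
    with coeff show ?case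
    proof eventually_elim
      case (elim \<tau>)
      have "h l \<tau> = (\<Sum>m\<in>{l}. slash_coeff (k - 2 * int m) m l * (D ^^ (m - l)) (F m) \<tau>)"
        unfolding h_def using less.prems elim(2)
        by (intro sum.mono_neutral_right) (auto simp: not_le linorder_neq_iff)
      moreover have "h l \<tau> = 0"
        using elim(1) less.prems assms(4) by (auto simp: N_def)
      ultimately show ?case
        using slash_coeff_diag_nonzero[OF less.prems(1)] by simp
    qed
  qed
  have "\<forall>\<^sub>\<approx>\<tau>\<in>?H. \<forall>l\<in>{l. k \<le> int l \<and> l \<le> l0}. (D ^^ (l - p)) (F l) \<tau> = 0"
    using F_zero by (intro eventually_ball_finite ballI cosparse_D_funpow_zero open_upper_half_plane) auto
  with coeff have "\<forall>\<^sub>\<approx>\<tau>\<in>?H. g p \<tau> = 0"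
  proof eventually_elim
    case (elim \<tau>)
    have "slash_coeff (k - 2 * int l) l p * (D ^^ (l - p)) (F l) \<tau> = 0" if "l \<le> l0" for l
    proof -
      have kp: "k \<le> 2 * int p"
        using assms(3) by linarith
      \<comment> \<open>The summand vanishes by the binomial coefficient, by the zero factor (here
        \<open>k \<le> 2 * p \<le> 2 * l\<close>), and by \<open>F_zero\<close>,
        respectively.\<close>
      consider "l < p" | "p \<le> l" "int l < k" | "k \<le> int l"
        by linarith
      then show ?thesis
        using slash_coeff_vanish[OF kp, of l] kp elim(2) that by cases auto
    qed
    then have "h p \<tau> = 0"
      unfolding h_def by (intro sum.neutral) auto
    then show ?case
      using elim(1) by (auto simp: N_def)
  qed
  with gp show False ..
qed

end
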